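(* Let $\alpha:\mathbb{R}\to[0,\infty)$ be an even convex function with $\alpha(0)=0$, and let $\psi:[0,\infty)\to[0,\infty)$ be non-decreasing with $\psi(0)=0$ and $\psi(s)>0$ for $s>0$. Let $\mu_0,\mu_1$ be arbitrary Borel probability measures on $\mathbb{R}$, and let $(\mu_t)_{t\in[0,1]}$ be their monotone interpolation. Then the function $t\mapsto\mathsf{T}_{\alpha,\psi}(\mu_t)$ is convex on $[0,1]$. In particular, \[ \mathsf{T}_{\alpha,\psi}(\mu_t)\leq(1-t)\,\mathsf{T}_{\alpha,\psi}(\mu_0)+t\,\mathsf{T}_{\alpha,\psi}(\mu_1),\qquad t\in(0,1). \]
   Context: For a probability measure $\mu$ on $\mathbb{R}$, its left-continuous quantile function is $Q_\mu(u)=\inf\{x\in\mathbb{R}:\mu((-\infty,x])\geq u\}$, $u\in(0,1)$. Let $\lambda$ be Lebesgue measure on $(0,1)$. The monotone interpolation between $\mu_0$ and $\mu_1$ is $\mu_t=(Q_t)_\#\lambda$ with $Q_t=(1-t)Q_{\mu_0}+tQ_{\mu_1}$, $t\in[0,1]$, where $T_\#\mu$ denotes the image of $\mu$ under $T$. $\mathcal{T}_\alpha(\mu,\nu)=\inf_{\pi\in\Pi(\mu,\nu)}\int\alpha(x-y)\,\mathrm{d}\pi(x,y)$, where $\Pi(\mu,\nu)$ is the set of couplings of $\mu$ and $\nu$. The relative entropy is $\mathrm{H}(\nu\mid\mu)=\int\log\left(\frac{\mathrm{d}\nu}{\mathrm{d}\mu}\right)\mathrm{d}\nu$ if $\nu\ll\mu$,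 and $+\infty$ otherwise. For a Borel probability measure $\mu$ on $\mathbb{R}$, \[ \mathsf{T}_{\alpha,\psi}(\mu)=\sup_{\nu:\;0<\mathrm{H}(\nu\mid\mu)<\infty}\frac{\mathcal{T}_\alpha(\mu,\nu)}{\psi(\mathrm{H}(\nu\mid\mu))}\in[0,+\infty], \] the supremum running over Borel probability measures $\nu$ on $\mathbb{R}$ (a supremum over the empty set is $0$, as constants take values in $[0,+\infty]$). Convexity is understood for $[0,+\infty]$-valued functions. *)

theory Defs
  imports "HOL-Probability.Probability"
begin

definition quantile :: "real measure \<Rightarrow> real \<Rightarrow> real" where
  "quantile \<mu> u = Inf {x. u \<le> cdf \<mu> x}"

definition monotone_interpolation :: "real measure \<Rightarrow> real measure \<Rightarrow> real \<Rightarrow> real measure" where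
  "monotone_interpolation \<mu>0 \<mu>1 t =
     distr (restrict_space lborel {0<..<1}) borel
       (\<lambda>u. (1 - t) * quantile \<mu>0 u + t * quantile \<mu>1 u)"

definition couplings :: "real measure \<Rightarrow> real measure \<Rightarrow> (real \<times> real) measure set" where
  "couplings \<mu> \<nu> =
     {\<pi>. prob_space \<pi> \<and> sets \<pi> = sets (borel \<Otimes>\<^sub>M borel) \<and>
         distr \<pi> borel fst = \<mu> \<and> distr \<pi> borel snd = \<nu>}"

definition transport_cost :: "(real \<Rightarrow> real) \<Rightarrow> real measure \<Rightarrow> real measure \<Rightarrow> ennreal" where
  "transport_cost \<alpha> \<mu> \<nu> =
     (INF \<pi>\<in>couplings \<mu> \<nu>. \<integral>\<^sup>+ z. ennreal (\<alpha> (fst z - snd z)) \<partial>\<pi>)"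

text \<open>
  For probability measures, the negative part of the logarithm of the density of \<open>\<nu>\<close> with
  respect to \<open>\<mu>\<close> always has a finite \<open>\<nu>\<close>-integral, so the integral of this logarithm is
  \<open>\<infinity>\<close> exactly when it is not integrable. The case distinction is needed because
  the Bochner integral in \<^const>\<open>KL_divergence\<close> is \<open>0\<close> there. The base \<open>exp 1\<close> gives the
  natural logarithm; note the order of the arguments of \<^const>\<open>KL_divergence\<close> and
  \<^const>\<open>absolutely_continuous\<close>, reference measure first.
\<close>

definition relative_entropy :: "'a measure \<Rightarrow> 'a measure \<Rightarrow> ereal" where
  "relative_entropy \<nu> \<mu> =
     (if absolutely_continuous \<mu> \<nu> \<and> integrable \<nu> (entropy_density (exp 1) \<mu> \<nu>)
      then ereal (KL_divergence (exp 1) \<mu> \<nu>) else \<infinity>)"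

definition transport_entropy_constant ::
    "(real \<Rightarrow> real) \<Rightarrow> (real \<Rightarrow> real) \<Rightarrow> real measure \<Rightarrow> ennreal" where
  "transport_entropy_constant \<alpha> \<psi> \<mu> =
     (SUP \<nu>\<in>{\<nu>. real_distribution \<nu> \<and> 0 < relative_entropy \<nu> \<mu> \<and> relative_entropy \<nu> \<mu> < \<infinity>}.
        transport_cost \<alpha> \<mu> \<nu> / ennreal (\<psi> (real_of_ereal (relative_entropy \<nu> \<mu>))))"

text \<open>The library's \<^const>\<open>convex_on\<close> is restricted to real-valued functions. Here
  \<open>0 * \<infinity> = 0\<close>, so the inequality is trivial at the end points.\<close>

definition ennreal_convex_on :: "'a::real_vector set \<Rightarrow> ('a \<Rightarrow> ennreal) \<Rightarrow> bool" where
  "ennreal_convex_on S f \<longleftrightarrow> convex S \<and>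
     (\<forall>x\<in>S. \<forall>y\<in>S. \<forall>u\<ge>0. \<forall>v\<ge>0. u + v = 1 \<longrightarrow>
        f (u *\<^sub>R x + v *\<^sub>R y) \<le> ennreal u * f x + ennreal v * f y)"

end

theory Submission
  imports Defs
begin

text \<open>
  Let \<open>Q\<close> be the interpolated quantile function and let \<open>\<nu>\<close> have density \<open>f\<close> with respect to
  \<open>\<mu>\<^sub>t\<close>. Pull \<open>\<nu>\<close> back to the probability density \<open>g = f \<circ> Q\<close> on the unit interval, which has the
  same entropy, and push \<open>g\<close> forward by \<open>Q\<^sub>0\<close> and \<open>Q\<^sub>1\<close> to obtain competitors \<open>\<nu>\<^sub>0\<close> and \<open>\<nu>\<^sub>1\<close>; by data
  processing their entropies are no larger. If \<open>S\<close> is the monotone map carrying Lebesgue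
  measure to \<open>g\<close>, then \<open>(Q, Q \<circ> S)\<close> is a coupling of \<open>\<mu>\<^sub>t\<close> and \<open>\<nu>\<close>, whose cost is at most the convex
  combination of the costs of \<open>(Q\<^sub>i, Q\<^sub>i \<circ> S)\<close>, and the latter couplings are comonotone, hence optimal.

  Optimality of comonotone couplings reduces to the hinge costs \<open>(x - y - s)\<^sup>+\<close>, because every
  even convex cost vanishing at \<open>0\<close> is a mixture of such hinges.
\<close>

section \<open>Optimality of comonotone couplings\<close>

text \<open>\<open>ennreal\<close> sends negative numbers to 0, so the left integrand is the hinge
  cost. It is the length of \<open>{Y \<omega>..<X \<omega> - s}\<close>, and Tonelli turns its
  integral into an integral of probabilities of corner events.\<close>

lemma nn_integral_hinge_eq:
  fixes X Y :: "'a \<Rightarrow> real"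
  assumes "sigma_finite_measure M"
    and [measurable]: "X \<in> borel_measurable M" "Y \<in> borel_measurable M"
  shows "(\<integral>\<^sup>+\<omega>. ennreal (X \<omega> - Y \<omega> - s) \<partial>M) =
    (\<integral>\<^sup>+a. emeasure M {\<omega> \<in> space M. Y \<omega> \<le> a \<and> a + s < X \<omega>} \<partial>lborel)"
proof -
  interpret sigma_finite_measure M by fact
  interpret pair_sigma_finite M "lborel :: real measure" ..
  have "ennreal (X \<omega> - Y \<omega> - s) = emeasure lborel {Y \<omega>..<X \<omega> - s}" for \<omega>
    by (cases "Y \<omega> \<le> X \<omega> - s") (simp_all add: algebra_simps ennreal_neg)
  then have "(\<integral>\<^sup>+\<omega>. ennreal (X \<omega> - Y \<omega> - s) \<partial>M) =
      (\<integral>\<^sup>+\<omega>. (\<integral>\<^sup>+a. indicator {a. Y \<omega> \<le> a \<and> a + s < X \<omega>} a \<partial>lborel) \<partial>M)"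
    by (auto intro!: nn_integral_cong arg_cong[where f = "emeasure lborel"])
  also have "\<dots> = (\<integral>\<^sup>+a. (\<integral>\<^sup>+\<omega>. indicator {a. Y \<omega> \<le> a \<and> a + s < X \<omega>} a \<partial>M) \<partial>lborel)"
    by (rule Fubini'[symmetric]) measurable
  also have "\<dots> = (\<integral>\<^sup>+a. emeasure M {\<omega> \<in> space M. Y \<omega> \<le> a \<and> a + s < X \<omega>} \<partial>lborel)"
  proof (intro nn_integral_cong)
    fix a
    have "(\<integral>\<^sup>+\<omega>. indicator {a. Y \<omega> \<le> a \<and> a + s < X \<omega>} a \<partial>M) =
        (\<integral>\<^sup>+\<omega>. indicator {\<omega> \<in> space M. Y \<omega> \<le> a \<and> a + s < X \<omega>} \<omega> \<partial>M)"
      by (intro nn_integral_cong) (auto simp: indicator_def)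
    then show "(\<integral>\<^sup>+\<omega>. indicator {a. Y \<omega> \<le> a \<and> a + s < X \<omega>} a \<partial>M) =
        emeasure M {\<omega> \<in> space M. Y \<omega> \<le> a \<and> a + s < X \<omega>}"
      by simp
  qed
  finally show ?thesis .
qed

definition comonotone_on :: "'a set \<Rightarrow> ('a \<Rightarrow> real) \<Rightarrow> ('a \<Rightarrow> real) \<Rightarrow> bool" where
  "comonotone_on S X Y \<longleftrightarrow>
     (\<forall>\<omega>\<in>S. \<forall>\<omega>'\<in>S. X \<omega> \<le> X \<omega>' \<and> Y \<omega> \<le> Y \<omega>' \<or> X \<omega>' \<le> X \<omega> \<and> Y \<omega>' \<le> Y \<omega>)"

lemma comonotone_on_commute: "comonotone_on S X Y \<longleftrightarrow> comonotone_on S Y X"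
  unfolding comonotone_on_def by blast

lemma comonotone_on_mono:
  fixes X Y :: "'a::linorder \<Rightarrow> real"
  assumes "mono_on S X" "mono_on S Y"
  shows "comonotone_on S X Y"
  unfolding comonotone_on_def using assms by (meson mono_onD linear)

text \<open>At each level \<open>a\<close>, comonotonicity makes \<open>{Y \<le> a}\<close> and
  \<open>{X \<le> a + s}\<close> nested. The mass of their difference is then the positive part of a
  difference of marginal masses, which is a lower bound for every pair with the same
  marginals.\<close>

lemma hinge_comonotone_le:
  fixes X Y :: "'a \<Rightarrow> real" and X' Y' :: "'b \<Rightarrow> real"
  assumes "prob_space M" "prob_space N"
    and [measurable]: "X \<in> borel_measurable M" "Y \<in> borel_measurable M"
      "X' \<in> borel_measurable N" "Y' \<in> borel_measurable N"
    and X: "distr N borel X' = distr M borel X" and Y: "distr N borel Y' = distr M borel Y"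
    and como: "comonotone_on (space M) X Y"
  shows "(\<integral>\<^sup>+\<omega>. ennreal (X \<omega> - Y \<omega> - s) \<partial>M) \<le> (\<integral>\<^sup>+\<omega>. ennreal (X' \<omega> - Y' \<omega> - s) \<partial>N)"
proof -
  interpret M: prob_space M by fact
  interpret N: prob_space N by fact
  have le: "emeasure M {\<omega> \<in> space M. Y \<omega> \<le> a \<and> a + s < X \<omega>} \<le>
      emeasure N {\<omega> \<in> space N. Y' \<omega> \<le> a \<and> a + s < X' \<omega>}" for a
  proof -
    let ?A = "{\<omega> \<in> space M. Y \<omega> \<le> a}" and ?B = "{\<omega> \<in> space M. X \<omega> \<le> a + s}"
    let ?A' = "{\<omega> \<in> space N. Y' \<omega> \<le> a}" and ?B' = "{\<omega> \<in> space N. X' \<omega> \<le> a + s}"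
    have "emeasure (distr N borel Y') {..a} = emeasure (distr M borel Y) {..a}"
      by (simp only: Y)
    then have A: "emeasure N ?A' = emeasure M ?A"
      by (simp add: emeasure_distr vimage_def Int_def conj_commute)
    have "emeasure (distr N borel X') {..a+s} = emeasure (distr M borel X) {..a+s}"
      by (simp only: X)
    then have B: "emeasure N ?B' = emeasure M ?B"
      by (simp add: emeasure_distr vimage_def Int_def conj_commute)
    have eq: "{\<omega> \<in> space M. Y \<omega> \<le> a \<and> a + s < X \<omega>} = ?A - ?B" by auto
    have eq': "{\<omega> \<in> space N. Y' \<omega> \<le> a \<and> a + s < X' \<omega>} = ?A' - ?B'" by auto
    show ?thesis
    proof (cases "?A \<subseteq> ?B")
      case True
      then have "{\<omega> \<in> space M. Y \<omega> \<le> a \<and> a + s < X \<omega>} = {}" by auto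
      then show ?thesis by (simp only: emeasure_empty zero_le)
    next
      case False
      \<comment> \<open>A point of \<open>?A\<close> outside \<open>?B\<close> exceeds every point
        of \<open>?B\<close> strictly in \<open>X\<close>, hence weakly in \<open>Y\<close>.\<close>
      have "?B \<subseteq> ?A"
        using False como unfolding comonotone_on_def by (smt (verit) mem_Collect_eq subsetI)
      then have "emeasure M (?A - ?B) = emeasure M ?A - emeasure M ?B"
        by (intro emeasure_Diff) auto
      also have "\<dots> = emeasure N ?A' - emeasure N ?B'" by (simp only: A B)
      also have "\<dots> \<le> emeasure N (?A' - ?B')"
      proof -
        have "emeasure N ?A' \<le> emeasure N ((?A' - ?B') \<union> ?B')"
          by (intro emeasure_mono) auto
        also have "\<dots> \<le> emeasure N (?A' - ?B') + emeasure N ?B'"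
          by (intro emeasure_subadditive) auto
        finally show ?thesis by (simp add: ennreal_minus_le_iff add.commute)
      qed
      finally show ?thesis unfolding eq eq' .
    qed
  qed
  show ?thesis
    unfolding nn_integral_hinge_eq[OF M.sigma_finite_measure_axioms assms(3,4)]
      nn_integral_hinge_eq[OF N.sigma_finite_measure_axioms assms(5,6)]
    by (intro nn_integral_mono le)
qed

section \<open>Supporting slopes and the hinge decomposition of even convex costs\<close>

text \<open>Any selection of supporting slopes qualifies, which leaves the slope at a minimum free
  to be prescribed.\<close>

definition subgradient :: "(real \<Rightarrow> real) \<Rightarrow> (real \<Rightarrow> real) \<Rightarrow> bool" where
  "subgradient f g \<longleftrightarrow> (\<forall>x y. f x + g x * (y - x) \<le> f y)"

lemma convex_on_UNIV_subgradient:
  fixes f :: "real \<Rightarrow> real"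
  assumes "convex_on UNIV f"
  obtains g where "subgradient f g"
proof
  \<comment> \<open>The infimum of the difference quotients to the right of \<open>x\<close> is the
    right derivative.\<close>
  show "subgradient f (\<lambda>x. Inf ((\<lambda>t. (f x - f t) / (x - t)) ` ({x<..} \<inter> UNIV)))"
    unfolding subgradient_def using convex_le_Inf_differential[OF assms] by simp
qed

lemma subgradient_mono:
  assumes "subgradient f g"
  shows "mono g"
proof (rule monoI)
  fix x y :: real
  assume "x \<le> y"
  have "f x + g x * (y - x) \<le> f y" "f y + g y * (x - y) \<le> f x"
    using assms unfolding subgradient_def by auto
  then have "g x * (y - x) \<le> g y * (y - x)"
    by (simp add: algebra_simps)
  with \<open>x \<le> y\<close> show "g x \<le> g y"
    by (cases "x = y") auto
qed

text \<open>On any interval both the increment of \<open>f\<close> and the integral of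
  \<open>g\<close> lie between the end slopes times the length. This bounds the variation of their
  difference \<open>D\<close>, and refining the partition forces that variation to be 0.\<close>

lemma subgradient_has_integral:
  assumes g: "subgradient f g" and "a \<le> b"
  shows "(g has_integral (f b - f a)) {a..b}"
proof -
  have mono: "g x \<le> g y" if "x \<le> y" for x y
    using subgradient_mono[OF g] that by (auto dest: monoD)
  have int: "g integrable_on {x..y}" for x y
    by (intro integrable_on_mono_on) (auto simp: mono_on_def mono)
  define D where "D t = f t - integral {a..t} g" for t
  have D: "\<bar>D y - D x\<bar> \<le> (g y - g x) * (y - x)" if "a \<le> x" "x \<le> y" for x y
  proof -
    have "integral {a..x} g + integral {x..y} g = integral {a..y} g"
      using that by (intro Henstock_Kurzweil_Integration.integral_combine int) auto
    moreover have "g x * (y - x) \<le> integral {x..y} g"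
      using that has_integral_le[OF has_integral_const_real[of "g x" x y] integrable_integral[OF int]]
      by (auto simp: mono mult.commute)
    moreover have "integral {x..y} g \<le> g y * (y - x)"
      using that has_integral_le[OF integrable_integral[OF int] has_integral_const_real[of "g y" x y]]
      by (auto simp: mono mult.commute)
    moreover have "f x + g x * (y - x) \<le> f y" "f y + g y * (x - y) \<le> f x"
      using g unfolding subgradient_def by auto
    ultimately show ?thesis
      unfolding D_def by (simp add: algebra_simps abs_le_iff)
  qed
  \<comment> \<open>Over \<open>Suc n\<close> steps of equal length \<open>h\<close> the slope
    differences telescope, leaving \<open>(g b - g a) * h\<close>.\<close>
  have bound: "\<bar>D b - D a\<bar> \<le> (g b - g a) * (b - a) / real (Suc n)" for n
  proof -
    define h where "h = (b - a) / real (Suc n)"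
    have "0 \<le> h" using \<open>a \<le> b\<close> by (simp add: h_def)
    have "\<bar>D (a + real k * h) - D a\<bar> \<le> (g (a + real k * h) - g a) * h" for k
    proof (induction k)
      case (Suc k)
      have "\<bar>D (a + real (Suc k) * h) - D (a + real k * h)\<bar> \<le>
          (g (a + real (Suc k) * h) - g (a + real k * h)) * (a + real (Suc k) * h - (a + real k * h))"
        using \<open>0 \<le> h\<close> by (intro D) (auto intro: mult_right_mono)
      with Suc show ?case
        by (simp add: algebra_simps abs_le_iff)
    qed simp
    from this[of "Suc n"] show ?thesis
      by (simp add: h_def del: of_nat_Suc)
  qed
  have "(\<lambda>n. (g b - g a) * (b - a) / real (Suc n)) \<longlonglongrightarrow> 0"
    by (rule LIMSEQ_Suc[OF lim_const_over_n])
  from LIMSEQ_le_const[OF this] bound have "\<bar>D b - D a\<bar> \<le> 0" by blast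
  then have "integral {a..b} g = f b - f a" by (simp add: D_def)
  with int[of a b] show ?thesis by (metis integrable_integral)
qed

text \<open>
  Writing \<open>\<alpha> z\<close> as the integral of its slope \<open>g\<close> over \<open>[0, \<bar>z\<bar>]\<close>, we take the layer-cake decomposition of
  \<open>g\<close> in the height \<open>r\<close>: since \<open>g\<close> is monotone, the layer at height \<open>r\<close> is a half-line from \<open>\<sigma> r\<close>, and
  \<open>R\<close> consists of the heights at which it is nonempty.
\<close>

lemma even_convex_eq_hinge_mixture:
  fixes \<alpha> :: "real \<Rightarrow> real"
  assumes nonneg: "\<And>x. 0 \<le> \<alpha> x" and even: "\<And>x. \<alpha> (- x) = \<alpha> x"
    and conv: "convex_on UNIV \<alpha>" and "\<alpha> 0 = 0"
  obtains R :: "real set" and \<sigma> :: "real \<Rightarrow> real"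
  where "R \<in> sets borel" "\<sigma> \<in> borel_measurable borel"
    "\<And>z. ennreal (\<alpha> z) =
      (\<integral>\<^sup>+r. indicator R r * (ennreal (z - \<sigma> r) + ennreal (- z - \<sigma> r)) \<partial>lborel)"
proof -
  obtain g0 where g0: "subgradient \<alpha> g0"
    using convex_on_UNIV_subgradient[OF conv] .
  \<comment> \<open>The point 0 minimises \<alpha>, so 0 is an admissible slope there; by
    monotonicity \<open>g\<close> is then nonnegative on \<open>{0..}\<close>.\<close>
  define g where "g = g0(0 := 0)"
  have g: "subgradient \<alpha> g"
    using g0 nonneg \<open>\<alpha> 0 = 0\<close> by (auto simp: subgradient_def g_def)
  have "mono g" by (rule subgradient_mono[OF g])
  then have mono: "g x \<le> g y" if "x \<le> y" for x y
    using that by (auto dest: monoD)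
  have [measurable]: "g \<in> borel_measurable borel"
    by (rule borel_measurable_mono) fact
  have g_nonneg: "0 \<le> g s" if "0 \<le> s" for s
    using mono[OF that] by (simp add: g_def)
  define U where "U r = {s. 0 \<le> s \<and> r < g s}" for r
  define R where "R = {r. 0 < r \<and> U r \<noteq> {}}"
  \<comment> \<open>The value 0 off \<open>R\<close> is a filler, hidden later by the factor
    \<open>indicator R r\<close>.\<close>
  define \<sigma> where "\<sigma> r = (if r \<in> R then Inf (U r) else 0)" for r
  have U_bdd: "bdd_below (U r)" for r
    by (auto simp: U_def intro: bdd_belowI[of _ 0])
  have "is_interval R"
    unfolding is_interval_1 R_def U_def by (auto intro: le_less_trans)
  then have R[measurable]: "R \<in> sets borel"
    by (rule real_interval_borel_measurable)
  \<comment> \<open>The sets \<open>U r\<close> shrink as \<open>r\<close> grows, so their infima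
    grow; this monotonicity gives measurability.\<close>
  have "mono_on R (\<lambda>r. Inf (U r))"
    by (rule mono_onI, rule cInf_superset_mono) (auto simp: R_def U_bdd, auto simp: U_def)
  then have "(\<lambda>r. Inf (U r)) \<in> borel_measurable (restrict_space borel R)"
    by (rule borel_measurable_mono_on_fnc)
  then have \<sigma>: "\<sigma> \<in> borel_measurable borel"
    unfolding \<sigma>_def by (subst measurable_If_restrict_space_iff) auto
  have \<sigma>_nonneg: "0 \<le> \<sigma> r" for r
    by (auto simp: \<sigma>_def R_def U_def intro!: cInf_greatest)
  \<comment> \<open>The layer is the interval from \<open>\<sigma> r\<close> to
    \<open>\<bar>z\<bar>\<close>, up to the left end point, which is a null set.\<close>
  have layer: "emeasure lborel {s. 0 \<le> s \<and> s \<le> \<bar>z\<bar> \<and> 0 < r \<and> r < g s} =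
      indicator R r * (ennreal (z - \<sigma> r) + ennreal (- z - \<sigma> r))" for r z
  proof (cases "r \<in> R")
    case False
    then have "{s. 0 \<le> s \<and> s \<le> \<bar>z\<bar> \<and> 0 < r \<and> r < g s} = {}"
      by (auto simp: R_def U_def)
    then have "emeasure lborel {s. 0 \<le> s \<and> s \<le> \<bar>z\<bar> \<and> 0 < r \<and> r < g s} = 0"
      by (simp only: emeasure_empty)
    with False show ?thesis by simp
  next
    case True
    then have \<sigma>_eq: "\<sigma> r = Inf (U r)" and "0 < r" "U r \<noteq> {}"
      by (auto simp: \<sigma>_def R_def)
    let ?S = "{s. 0 \<le> s \<and> s \<le> \<bar>z\<bar> \<and> 0 < r \<and> r < g s}"
    have "?S \<subseteq> {\<sigma> r..\<bar>z\<bar>}"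
      unfolding \<sigma>_eq by (auto intro!: cInf_lower U_bdd simp: U_def)
    then have "emeasure lborel ?S \<le> emeasure lborel {\<sigma> r..\<bar>z\<bar>}"
      by (intro emeasure_mono) auto
    moreover have "{\<sigma> r<..\<bar>z\<bar>} \<subseteq> ?S"
    proof
      fix s assume s: "s \<in> {\<sigma> r<..\<bar>z\<bar>}"
      then obtain s' where "s' \<in> U r" "s' < s"
        using cInf_lessD[OF \<open>U r \<noteq> {}\<close>, of s] by (auto simp: \<sigma>_eq)
      then show "s \<in> ?S"
        using s \<open>0 < r\<close> mono[of s' s] by (auto simp: U_def)
    qed
    then have "emeasure lborel {\<sigma> r<..\<bar>z\<bar>} \<le> emeasure lborel ?S"
      by (intro emeasure_mono) auto
    moreover have "emeasure lborel {\<sigma> r..\<bar>z\<bar>} = ennreal (\<bar>z\<bar> - \<sigma> r)"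
      "emeasure lborel {\<sigma> r<..\<bar>z\<bar>} = ennreal (\<bar>z\<bar> - \<sigma> r)"
      by (cases "\<sigma> r \<le> \<bar>z\<bar>"; simp add: ennreal_neg)+
    ultimately have "emeasure lborel ?S = ennreal (\<bar>z\<bar> - \<sigma> r)"
      by (metis antisym)
    \<comment> \<open>Since \<open>\<sigma> r\<close> is nonnegative, at most one of the two hinges
      is positive.\<close>
    also have "\<dots> = ennreal (z - \<sigma> r) + ennreal (- z - \<sigma> r)"
      using \<sigma>_nonneg[of r] by (cases "0 \<le> z") (auto simp: ennreal_neg)
    finally show ?thesis using True by simp
  qed
  have "ennreal (\<alpha> z) =
      (\<integral>\<^sup>+r. indicator R r * (ennreal (z - \<sigma> r) + ennreal (- z - \<sigma> r)) \<partial>lborel)" for z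
  proof -
    have "\<alpha> z = \<alpha> \<bar>z\<bar>" using even[of z] by (auto simp: abs_if)
    then have "(g has_integral \<alpha> z) {0..\<bar>z\<bar>}"
      using subgradient_has_integral[OF g, of 0 "\<bar>z\<bar>"] \<open>\<alpha> 0 = 0\<close> by simp
    then have "ennreal (\<alpha> z) = (\<integral>\<^sup>+s. ennreal (g s) * indicator {0..\<bar>z\<bar>} s \<partial>lborel)"
      by (intro nn_integral_has_integral_lebesgue'[symmetric]) (auto simp: g_nonneg)
    also have "\<dots> = (\<integral>\<^sup>+s. (\<integral>\<^sup>+r. indicator {r. 0 \<le> s \<and> s \<le> \<bar>z\<bar> \<and> 0 < r \<and> r < g s} r \<partial>lborel) \<partial>lborel)"
    proof (intro nn_integral_cong)
      fix s
      have "{r. 0 \<le> s \<and> s \<le> \<bar>z\<bar> \<and> 0 < r \<and> r < g s} = (if s \<in> {0..\<bar>z\<bar>} then {0<..<g s} else {})"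
        by auto
      then show "ennreal (g s) * indicator {0..\<bar>z\<bar>} s =
          (\<integral>\<^sup>+r. indicator {r. 0 \<le> s \<and> s \<le> \<bar>z\<bar> \<and> 0 < r \<and> r < g s} r \<partial>lborel)"
        by (simp add: g_nonneg)
    qed
    also have "\<dots> = (\<integral>\<^sup>+r. (\<integral>\<^sup>+s. indicator {r. 0 \<le> s \<and> s \<le> \<bar>z\<bar> \<and> 0 < r \<and> r < g s} r \<partial>lborel) \<partial>lborel)"
      by (rule lborel_pair.Fubini'[symmetric]) measurable
    also have "\<dots> = (\<integral>\<^sup>+r. emeasure lborel {s. 0 \<le> s \<and> s \<le> \<bar>z\<bar> \<and> 0 < r \<and> r < g s} \<partial>lborel)"
    proof (intro nn_integral_cong)
      fix r
      have "(\<integral>\<^sup>+s. indicator {r. 0 \<le> s \<and> s \<le> \<bar>z\<bar> \<and> 0 < r \<and> r < g s} r \<partial>lborel) =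
        (\<integral>\<^sup>+s. indicator {s. 0 \<le> s \<and> s \<le> \<bar>z\<bar> \<and> 0 < r \<and> r < g s} s \<partial>lborel)"
        by (simp add: indicator_def)
      then show "(\<integral>\<^sup>+s. indicator {r. 0 \<le> s \<and> s \<le> \<bar>z\<bar> \<and> 0 < r \<and> r < g s} r \<partial>lborel) =
          emeasure lborel {s. 0 \<le> s \<and> s \<le> \<bar>z\<bar> \<and> 0 < r \<and> r < g s}"
        by simp
    qed
    finally show ?thesis unfolding layer .
  qed
  with R \<sigma> show thesis by (rule that)
qed

text \<open>Fubini over the mixture reduces the claim to hinges. The two hinges at each height
  differ by exchanging \<open>X\<close> and \<open>Y\<close>, and comonotonicity is
  symmetric.\<close>

lemma comonotone_cost_le:
  fixes X Y :: "'a \<Rightarrow> real" and X' Y' :: "'b \<Rightarrow> real" and \<alpha> :: "real \<Rightarrow> real"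
  assumes \<alpha>: "\<And>x. 0 \<le> \<alpha> x" "\<And>x. \<alpha> (- x) = \<alpha> x" "convex_on UNIV \<alpha>" "\<alpha> 0 = 0"
    and "prob_space M" "prob_space N"
    and [measurable]: "X \<in> borel_measurable M" "Y \<in> borel_measurable M"
      "X' \<in> borel_measurable N" "Y' \<in> borel_measurable N"
    and X: "distr N borel X' = distr M borel X" and Y: "distr N borel Y' = distr M borel Y"
    and como: "comonotone_on (space M) X Y"
  shows "(\<integral>\<^sup>+\<omega>. ennreal (\<alpha> (X \<omega> - Y \<omega>)) \<partial>M) \<le> (\<integral>\<^sup>+\<omega>. ennreal (\<alpha> (X' \<omega> - Y' \<omega>)) \<partial>N)"
proof (rule even_convex_eq_hinge_mixture[OF \<alpha>])
  fix R :: "real set" and \<sigma> :: "real \<Rightarrow> real"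
  assume [measurable]: "R \<in> sets borel" "\<sigma> \<in> borel_measurable borel"
    and eq: "\<And>z. ennreal (\<alpha> z) =
      (\<integral>\<^sup>+r. indicator R r * (ennreal (z - \<sigma> r) + ennreal (- z - \<sigma> r)) \<partial>lborel)"
  have cost_eq: "(\<integral>\<^sup>+\<omega>. ennreal (\<alpha> (A \<omega> - B \<omega>)) \<partial>P) =
      (\<integral>\<^sup>+r. indicator R r * ((\<integral>\<^sup>+\<omega>. ennreal (A \<omega> - B \<omega> - \<sigma> r) \<partial>P) +
        (\<integral>\<^sup>+\<omega>. ennreal (B \<omega> - A \<omega> - \<sigma> r) \<partial>P)) \<partial>lborel)"
    if "prob_space P" and [measurable]: "A \<in> borel_measurable P" "B \<in> borel_measurable P"
    for P :: "'c measure" and A B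
  proof -
    interpret P: prob_space P by fact
    interpret pair_sigma_finite P "lborel :: real measure" ..
    have "(\<integral>\<^sup>+\<omega>. ennreal (\<alpha> (A \<omega> - B \<omega>)) \<partial>P) =
        (\<integral>\<^sup>+\<omega>. (\<integral>\<^sup>+r. indicator R r * (ennreal (A \<omega> - B \<omega> - \<sigma> r) + ennreal (B \<omega> - A \<omega> - \<sigma> r)) \<partial>lborel) \<partial>P)"
      unfolding eq by simp
    also have "\<dots> =
        (\<integral>\<^sup>+r. (\<integral>\<^sup>+\<omega>. indicator R r * (ennreal (A \<omega> - B \<omega> - \<sigma> r) + ennreal (B \<omega> - A \<omega> - \<sigma> r)) \<partial>P) \<partial>lborel)"
      by (rule Fubini'[symmetric]) measurable
    finally show ?thesis
      by (simp add: nn_integral_cmult nn_integral_add)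
  qed
  show ?thesis
    unfolding cost_eq[OF assms(5,7,8)] cost_eq[OF assms(6,9,10)]
    using como
    by (intro nn_integral_mono mult_left_mono add_mono hinge_comonotone_le assms)
      (simp_all add: comonotone_on_commute)
qed

section \<open>Relative entropy of image measures\<close>

text \<open>Uniqueness of the Radon-Nikodym derivative identifies the entropy density with
  \<open>ln (D x)\<close> almost everywhere, so entropies become integrals over the reference space.
  Where \<open>D\<close> vanishes the integrand is 0, the convention 0 log 0 = 0.\<close>

lemma relative_entropy_density:
  fixes D :: "'a \<Rightarrow> real"
  assumes "sigma_finite_measure M"
    and [measurable]: "D \<in> borel_measurable M" and nn: "\<And>x. 0 \<le> D x"
  shows "relative_entropy (density M D) M =
    (if integrable M (\<lambda>x. D x * ln (D x)) then ereal (\<integral>x. D x * ln (D x) \<partial>M) else \<infinity>)"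
proof -
  interpret sigma_finite_measure M by fact
  let ?N = "density M D"
  have ac: "absolutely_continuous M ?N"
    by (intro absolutely_continuousI_density) simp
  have log_eq: "log (exp 1) x = ln x" for x :: real
    by (simp add: log_def)
  have "AE x in M. ennreal (D x) = RN_deriv M ?N x"
    by (intro RN_deriv_unique) auto
  then have "AE x in M. entropy_density (exp 1) M ?N x = ln (D x)"
  proof eventually_elim
    case (elim x)
    then show ?case by (simp add: entropy_density_def log_eq nn flip: elim)
  qed
  then have "AE x in ?N. entropy_density (exp 1) M ?N x = ln (D x)"
    by (rule absolutely_continuous_AE[OF sets_density ac])
  then have "integrable ?N (entropy_density (exp 1) M ?N) \<longleftrightarrow> integrable ?N (\<lambda>x. ln (D x))"
    by (intro integrable_cong_AE) (auto simp: measurable_entropy_density)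
  also have "\<dots> \<longleftrightarrow> integrable M (\<lambda>x. D x * ln (D x))"
    by (subst integrable_density) (auto simp: nn)
  finally show ?thesis
    using ac KL_density[of "exp 1" D] by (simp add: relative_entropy_def nn log_eq)
qed

text \<open>The Radon-Nikodym derivative of a finite measure is finite almost everywhere, so it has
  a nonnegative real version, to which \<open>ln\<close> and Bochner integrals apply.\<close>

lemma absolutely_continuous_real_density:
  assumes "sigma_finite_measure M" "finite_measure N" "absolutely_continuous M N" "sets N = sets M"
  shows "\<exists>D. D \<in> measurable M (borel :: real measure) \<and> (\<forall>x. 0 \<le> D x) \<and> N = density M D"
proof -
  interpret sigma_finite_measure M by fact
  from real_RN_deriv[OF assms(2-4)] obtain D where D: "D \<in> borel_measurable M"
    "AE x in M. RN_deriv M N x = ennreal (D x)" "\<And>x. 0 \<le> D x" by metis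
  have "N = density M (RN_deriv M N)"
    using assms by (simp add: density_RN_deriv)
  also have "\<dots> = density M D"
    using D by (intro density_cong) auto
  finally show ?thesis using D by blast
qed

text \<open>This is the strict form of Gibbs' inequality. On the line it makes every distribution
  other than the reference one, if of finite entropy, a competitor in the supremum.\<close>

lemma relative_entropy_pos:
  assumes "prob_space M" "prob_space N" "sets N = sets M" "N \<noteq> M"
  shows "0 < relative_entropy N M"
proof (cases "absolutely_continuous M N")
  case True
  interpret M: prob_space M by fact
  interpret N: prob_space N by fact
  interpret information_space M "exp 1" by standard simp
  from absolutely_continuous_real_density[OF M.sigma_finite_measure_axioms
      N.finite_measure_axioms True assms(3)]
  obtain D :: "'a \<Rightarrow> real"
    where D: "D \<in> measurable M (borel :: real measure)" "\<And>x. 0 \<le> D x" "N = density M D" by blast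
  have log_eq: "log (exp 1) x = ln x" for x :: real
    by (simp add: log_def)
  show ?thesis
    using relative_entropy_density[OF M.sigma_finite_measure_axioms D(1,2)] KL_gt_0[of D]
      M.KL_density[of "exp 1" D] assms D
    by (auto simp: log_eq)
qed (simp add: relative_entropy_def)

text \<open>A density that factors through \<open>T\<close> loses no information under
  \<open>T\<close>: both sides are the same integral after a change of variables.\<close>

lemma relative_entropy_density_distr:
  fixes f :: "'b \<Rightarrow> real"
  assumes "prob_space M"
    and T[measurable]: "T \<in> measurable M N" and [measurable]: "f \<in> borel_measurable N"
    and nn: "\<And>x. 0 \<le> f x"
  shows "relative_entropy (density (distr M N T) f) (distr M N T) =
    relative_entropy (density M (\<lambda>x. f (T x))) M"
proof -
  interpret prob_space M by fact
  interpret D: prob_space "distr M N T" by (rule prob_space_distr) fact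
  show ?thesis
    by (simp add: relative_entropy_density nn sigma_finite_measure_axioms
        D.sigma_finite_measure_axioms integrable_distr_eq integral_distr)
qed

section \<open>Data processing for relative entropy\<close>

text \<open>The left side is the tangent of the convex function x ln x at \<open>c\<close>,
  evaluated at \<open>g\<close>: it equals c ln c + (1 + ln c)(g - c).\<close>

lemma entropy_tangent:
  fixes c g :: real
  assumes "0 < c" "0 \<le> g"
  shows "g * ln c + g - c \<le> g * ln g"
proof (cases "g = 0")
  case False
  then have "0 < g" using assms by simp
  then have "g * ln (c / g) \<le> g * (c / g - 1)"
    using assms by (intro mult_left_mono ln_le_minus_one) auto
  then show ?thesis
    using \<open>0 < g\<close> assms by (simp add: ln_div algebra_simps)
qed (use assms in simp)

text \<open>
  With \<open>c = D \<circ> T\<close>, where \<open>D\<close> is the density of the image measures, \<open>g\<close> and \<open>c\<close> have the same integrals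
  against functions of \<open>T\<close>, so integrating the tangent inequality at \<open>c\<close> replaces conditional Jensen.
\<close>

lemma relative_entropy_distr_le:
  fixes g :: "'a \<Rightarrow> real"
  assumes "prob_space M"
    and [measurable]: "g \<in> borel_measurable M" and g_nn: "\<And>x. 0 \<le> g x"
    and "prob_space (density M g)" and T[measurable]: "T \<in> measurable M N"
  shows "relative_entropy (distr (density M g) N T) (distr M N T) \<le> relative_entropy (density M g) M"
proof (cases "integrable M (\<lambda>x. g x * ln (g x))")
  case int_glng: True
  interpret M: prob_space M by fact
  interpret G: prob_space "density M g" by fact
  let ?\<mu> = "distr M N T" and ?\<nu> = "distr (density M g) N T"
  interpret \<mu>: prob_space ?\<mu> by (rule M.prob_space_distr) fact
  interpret \<nu>: prob_space ?\<nu> by (rule G.prob_space_distr) simp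
  have "absolutely_continuous ?\<mu> ?\<nu>"
    unfolding absolutely_continuous_def
  proof
    fix A assume "A \<in> null_sets ?\<mu>"
    then have "T -` A \<inter> space M \<in> null_sets M" and A: "A \<in> sets N"
      by (simp_all add: null_sets_distr_iff)
    then have "T -` A \<inter> space M \<in> null_sets (density M g)"
      using absolutely_continuousI_density[of "\<lambda>x. ennreal (g x)" M]
      by (auto simp: absolutely_continuous_def)
    with A show "A \<in> null_sets ?\<nu>"
      by (simp add: null_sets_distr_iff)
  qed
  then obtain D :: "_ \<Rightarrow> real" where D: "D \<in> measurable ?\<mu> (borel :: real measure)" and D_nn: "\<And>x. 0 \<le> D x"
    and \<nu>_eq: "?\<nu> = density ?\<mu> D"
    using absolutely_continuous_real_density[OF \<mu>.sigma_finite_measure_axioms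
          \<nu>.finite_measure_axioms] by auto
  from D have D_meas[measurable]: "D \<in> borel_measurable N" by simp
  \<comment> \<open>\<open>c\<close> is a version of the conditional expectation of \<open>g\<close>
    given \<open>T\<close>; the swap facts below express this.\<close>
  define c where "c x = D (T x)" for x
  have c_meas[measurable]: "c \<in> borel_measurable M" unfolding c_def by simp
  have c_nn: "0 \<le> c x" for x by (simp add: c_def D_nn)
  have \<nu>_eq': "distr (density M g) N T = distr (density M c) N T"
    unfolding \<nu>_eq c_def by (simp add: density_distr)
  have swap_nn: "(\<integral>\<^sup>+x. ennreal (g x) * h (T x) \<partial>M) = (\<integral>\<^sup>+x. ennreal (c x) * h (T x) \<partial>M)"
    if [measurable]: "h \<in> borel_measurable N" for h
  proof -
    have "(\<integral>\<^sup>+x. h x \<partial>distr (density M g) N T) = (\<integral>\<^sup>+x. h x \<partial>distr (density M c) N T)"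
      by (simp only: \<nu>_eq')
    then show ?thesis by (simp add: nn_integral_distr nn_integral_density)
  qed
  have swap_integrable:
    "integrable M (\<lambda>x. g x * h (T x)) \<longleftrightarrow> integrable M (\<lambda>x. c x * h (T x))"
    and swap_integral: "(\<integral>x. g x * h (T x) \<partial>M) = (\<integral>x. c x * h (T x) \<partial>M)"
    if [measurable]: "h \<in> borel_measurable N" for h :: "_ \<Rightarrow> real"
  proof -
    have "integrable (distr (density M g) N T) h \<longleftrightarrow> integrable (distr (density M c) N T) h"
      by (simp only: \<nu>_eq')
    then show "integrable M (\<lambda>x. g x * h (T x)) \<longleftrightarrow> integrable M (\<lambda>x. c x * h (T x))"
      by (simp add: integrable_distr_eq integrable_density g_nn c_nn)
    have "(\<integral>x. h x \<partial>distr (density M g) N T) = (\<integral>x. h x \<partial>distr (density M c) N T)"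
      by (simp only: \<nu>_eq')
    then show "(\<integral>x. g x * h (T x) \<partial>M) = (\<integral>x. c x * h (T x) \<partial>M)"
      by (simp add: integral_distr integral_density g_nn c_nn)
  qed
  have "(\<integral>\<^sup>+x. ennreal (g x) \<partial>M) = 1"
    using G.emeasure_space_1 by (simp add: emeasure_density cong: nn_integral_cong)
  then have int_g: "integrable M g"
    by (intro integrableI_nn_integral_finite[where x = 1]) (auto simp: g_nn)
  with swap_integrable[of "\<lambda>_. 1"] swap_integral[of "\<lambda>_. 1"]
  have int_c: "integrable M c" and eq_gc: "(\<integral>x. g x \<partial>M) = (\<integral>x. c x \<partial>M)" by simp_all
  \<comment> \<open>\<open>c * \<bar>ln c\<bar> \<le> 1\<close> where \<open>c \<le> 1\<close>; where \<open>c > 1\<close> the tangent inequality dominates \<open>g * ln c\<close>.\<close>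
  let ?k = "\<lambda>y. if D y \<le> 1 then \<bar>ln (D y)\<bar> else 0"
  have "integrable M (\<lambda>x. c x * ?k (T x))"
  proof (rule integrableI_bounded)
    have "\<bar>c x * ?k (T x)\<bar> \<le> 1" for x
    proof (cases "0 < c x \<and> c x \<le> 1")
      case True
      then have "ln (1 / c x) \<le> 1 / c x - 1" by (intro ln_le_minus_one) simp
      with True have "c x * (- ln (c x)) \<le> c x * (1 / c x - 1)"
        by (intro mult_left_mono) (auto simp: ln_div)
      moreover have "c x * (1 / c x - 1) \<le> 1"
        using True by (simp add: field_simps)
      moreover have "ln (c x) \<le> 0" using True by simp
      ultimately show ?thesis using True by (simp add: c_def abs_mult)
    next
      case False
      with c_nn[of x] have "c x = 0 \<or> 1 < c x" by linarith
      then show ?thesis by (auto simp: c_def)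
    qed
    then have "(\<integral>\<^sup>+x. norm (c x * ?k (T x)) \<partial>M) \<le> (\<integral>\<^sup>+x. 1 \<partial>M)"
      by (intro nn_integral_mono) (simp del: ennreal_1 add: ennreal_1[symmetric])
    then show "(\<integral>\<^sup>+x. norm (c x * ?k (T x)) \<partial>M) < \<infinity>"
      by (auto simp: M.emeasure_space_1 intro: le_less_trans)
  qed measurable
  then have int_gk: "integrable M (\<lambda>x. g x * ?k (T x))"
    using swap_integrable[of ?k] by simp
  have int_glnc: "integrable M (\<lambda>x. g x * ln (c x))"
  proof (rule Bochner_Integration.integrable_bound)
    show "integrable M (\<lambda>x. (\<bar>g x * ln (g x)\<bar> + c x) + g x * ?k (T x))"
      using int_glng int_c int_gk by (intro Bochner_Integration.integrable_add) auto
    show "AE x in M. norm (g x * ln (c x)) \<le> norm ((\<bar>g x * ln (g x)\<bar> + c x) + g x * ?k (T x))"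
    proof (intro AE_I2)
      fix x
      show "norm (g x * ln (c x)) \<le> norm ((\<bar>g x * ln (g x)\<bar> + c x) + g x * ?k (T x))"
      proof (cases "c x \<le> 1")
        case True
        then show ?thesis
          using g_nn[of x] c_nn[of x] by (simp add: c_def abs_mult)
      next
        case False
        then have "0 \<le> g x * ln (c x)" using g_nn[of x] by simp
        moreover have "g x * ln (c x) \<le> \<bar>g x * ln (g x)\<bar> + c x"
          using entropy_tangent[of "c x" "g x"] False g_nn[of x] by linarith
        ultimately show ?thesis using False by (simp add: c_def)
      qed
    qed
  qed measurable
  then have int_clnc: "integrable M (\<lambda>x. c x * ln (c x))"
    using swap_integrable[of "\<lambda>y. ln (D y)"] by (simp add: c_def)
  \<comment> \<open>The tangent inequality requires a positive base point. Testing against the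
    indicator of the zero set of \<open>D\<close> shows that \<open>g\<close> vanishes almost
    everywhere where \<open>c\<close> does.\<close>
  have "(\<integral>\<^sup>+x. ennreal (g x) * indicator {y\<in>space N. D y = 0} (T x) \<partial>M) =
      (\<integral>\<^sup>+x. ennreal (c x) * indicator {y\<in>space N. D y = 0} (T x) \<partial>M)"
    by (rule swap_nn) measurable
  also have "\<dots> = (\<integral>\<^sup>+x. 0 \<partial>M)"
    by (intro nn_integral_cong) (auto simp: c_def indicator_def)
  finally have "(\<integral>\<^sup>+x. ennreal (g x) * indicator {y\<in>space N. D y = 0} (T x) \<partial>M) = 0"
    by simp
  then have "AE x in M. ennreal (g x) * indicator {y\<in>space N. D y = 0} (T x) = 0"
    by (subst nn_integral_0_iff_AE[symmetric]) measurable
  then have ae: "AE x in M. c x = 0 \<longrightarrow> g x = 0"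
    using AE_space
  proof eventually_elim
    case (elim x)
    then show ?case
      using measurable_space[OF T, of x] g_nn[of x] by (auto simp: c_def)
  qed
  have "(\<integral>x. c x * ln (c x) \<partial>M) = (\<integral>x. g x * ln (c x) \<partial>M)"
    using swap_integral[of "\<lambda>y. ln (D y)"] by (simp add: c_def)
  \<comment> \<open>The added terms \<open>g x - c x\<close> integrate to 0 and complete the tangent
    expression.\<close>
  also have "\<dots> = (\<integral>x. g x * ln (c x) + g x - c x \<partial>M)"
    using int_g int_c int_glnc eq_gc by simp
  also have "\<dots> \<le> (\<integral>x. g x * ln (g x) \<partial>M)"
  proof (rule integral_mono_AE)
    show "AE x in M. g x * ln (c x) + g x - c x \<le> g x * ln (g x)"
      using ae
    proof eventually_elim
      case (elim x)
      then show ?case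
        using entropy_tangent[of "c x" "g x"] c_nn[of x] g_nn[of x] by (cases "c x = 0") auto
    qed
  qed (use int_g int_c int_glnc int_glng in auto)
  finally have le: "(\<integral>x. c x * ln (c x) \<partial>M) \<le> (\<integral>x. g x * ln (g x) \<partial>M)" .
  \<comment> \<open>\<open>c\<close> factors through \<open>T\<close>, so passing to the image
    preserves its entropy exactly.\<close>
  have "relative_entropy ?\<nu> ?\<mu> = relative_entropy (density M c) M"
    unfolding \<nu>_eq c_def by (rule relative_entropy_density_distr) (auto simp: D_nn M.prob_space_axioms)
  also have "\<dots> \<le> relative_entropy (density M g) M"
    using le int_clnc int_glng
    by (simp add: relative_entropy_density[OF M.sigma_finite_measure_axioms] c_nn g_nn)
  finally show ?thesis .
next
  case False
  interpret M: prob_space M by fact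
  show ?thesis
    using False by (simp add: relative_entropy_density[OF M.sigma_finite_measure_axioms] g_nn)
qed

section \<open>Monotone maps on the unit interval\<close>

abbreviation unit_interval_measure :: "real measure" where
  "unit_interval_measure \<equiv> restrict_space lborel {0<..<1}"

lemma prob_space_unit_interval_measure: "prob_space unit_interval_measure"
  by (auto simp: emeasure_restrict_space space_restrict_space intro!: prob_spaceI)

lemma measurable_unit_interval_mono:
  fixes X :: "real \<Rightarrow> real"
  assumes "mono_on {0<..<1} X"
  shows "X \<in> borel_measurable unit_interval_measure"
  using borel_measurable_mono_on_fnc[OF assms]
  by (simp cong: measurable_cong_sets sets_restrict_space_cong)

lemma distr_quantile:
  assumes "real_distribution \<mu>"
  shows "distr unit_interval_measure borel (quantile \<mu>) = \<mu>"
proof -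
  interpret cdf_distribution \<mu> using assms by (simp add: cdf_distribution_def)
  show ?thesis using distr_I_eq_M by (simp add: quantile_def[abs_def])
qed

lemma mono_on_quantile:
  assumes "real_distribution \<mu>"
  shows "mono_on {0<..<1} (quantile \<mu>)"
proof -
  interpret cdf_distribution \<mu> using assms by (simp add: cdf_distribution_def)
  show ?thesis using mono_I by (simp add: quantile_def[abs_def])
qed

text \<open>The quantile function of \<open>N\<close>, seen as a measure on the line, is monotone
  and carries Lebesgue measure to \<open>N\<close>. The remaining point is that its values stay in
  the open interval, so that it can be composed with functions monotone only there.\<close>

lemma monotone_rearrangement:
  assumes "prob_space N" and sets: "sets N = sets unit_interval_measure"
  obtains S where "mono_on {0<..<1} S" "S \<in> measurable unit_interval_measure unit_interval_measure"
    "distr unit_interval_measure unit_interval_measure S = N"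
proof -
  interpret N: prob_space N by fact
  let ?\<Omega> = "unit_interval_measure"
  have space: "space N = {0<..<1}"
    using sets_eq_imp_space_eq[OF sets] by (simp add: space_restrict_space)
  have id_meas: "(\<lambda>x. x) \<in> measurable N borel"
    using measurable_unit_interval_mono[of "\<lambda>x. x"]
    by (simp add: mono_on_def measurable_cong_sets[OF sets refl])
  define \<rho> where "\<rho> = distr N borel (\<lambda>x. x)"
  have real_\<rho>: "real_distribution \<rho>"
    unfolding \<rho>_def by (rule N.real_distribution_distr[OF id_meas])
  interpret \<rho>: cdf_distribution \<rho>
    using real_\<rho> by (simp add: cdf_distribution_def)
  define S where "S = quantile \<rho>"
  have galois: "u \<le> cdf \<rho> x \<longleftrightarrow> S u \<le> x" if "u \<in> {0<..<1}" for u x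
    using that \<rho>.pseudoinverse[of u x] by (simp add: S_def quantile_def)
  have mono: "mono_on {0<..<1} S"
    unfolding S_def by (rule mono_on_quantile[OF real_\<rho>])
  have S_meas: "S \<in> borel_measurable ?\<Omega>"
    by (rule measurable_unit_interval_mono[OF mono])
  have S_range: "S u \<in> {0<..<1}" if u: "u \<in> {0<..<1}" for u
  proof -
    \<comment> \<open>No mass lies in \<open>{..0}\<close>, so the distribution function at 0 is
      below \<open>u\<close>, which places \<open>S u\<close> above 0.\<close>
    have "{..0} \<inter> {0<..<1::real} = {}" by auto
    then have "measure \<rho> {..0} = 0"
      unfolding \<rho>_def by (subst measure_distr[OF id_meas]) (auto simp: space)
    then have "\<not> u \<le> cdf \<rho> 0" using u by (simp add: cdf_def)
    \<comment> \<open>Otherwise the distribution function is at most \<open>u\<close> to the left of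
      1. Its left limit at 1 is the mass of \<open>{..<1}\<close>, which is the full mass 1, while
      \<open>u < 1\<close>.\<close>
    moreover have "S u < 1"
    proof (rule ccontr)
      assume "\<not> S u < 1"
      then have "cdf \<rho> x \<le> u" if "x < 1" for x
        using galois[OF u, of x] that by linarith
      then have "eventually (\<lambda>x. cdf \<rho> x \<le> u) (at_left 1)"
        by (auto simp: eventually_at_filter)
      then have "measure \<rho> {..<1} \<le> u"
        by (intro tendsto_upperbound[OF \<rho>.cdf_at_left]) auto
      moreover have "measure \<rho> {..<1} = measure N (space N)"
        unfolding \<rho>_def by (subst measure_distr[OF id_meas]) (auto simp: space intro!: arg_cong[where f = "measure N"])
      ultimately show False using u by (simp add: N.prob_space)
    qed
    ultimately show ?thesis using galois[OF u, of 0] by simp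
  qed
  have S_meas': "S \<in> measurable ?\<Omega> ?\<Omega>"
    using S_meas S_range
    by (intro measurable_restrict_space2) (auto simp: space_restrict_space)
  have "distr ?\<Omega> ?\<Omega> S = N"
  proof (rule measure_eqI)
    fix A assume "A \<in> sets (distr ?\<Omega> ?\<Omega> S)"
    then have A: "A \<in> sets ?\<Omega>" by simp
    then have A': "A \<in> sets borel" "A \<subseteq> {0<..<1}"
      by (auto simp: sets_restrict_space_iff)
    have "emeasure (distr ?\<Omega> ?\<Omega> S) A = emeasure (distr ?\<Omega> borel S) A"
      using A A' S_meas S_meas' by (simp add: emeasure_distr)
    also have "distr ?\<Omega> borel S = \<rho>"
      unfolding S_def by (rule distr_quantile[OF real_\<rho>])
    also have "emeasure \<rho> A = emeasure N A"
      using A' unfolding \<rho>_def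
      by (subst emeasure_distr[OF id_meas]) (auto simp: space Int_absorb2)
    finally show "emeasure (distr ?\<Omega> ?\<Omega> S) A = emeasure N A" .
  qed (simp add: sets)
  with mono S_meas' that show thesis by blast
qed

section \<open>Transport-entropy constants\<close>

text \<open>The diagonal coupling costs nothing. This settles the case of equal measures, which the
  supremum excludes because their entropy is 0.\<close>

lemma transport_cost_self:
  assumes "real_distribution \<mu>" and [measurable]: "\<alpha> \<in> borel_measurable borel" and "\<alpha> 0 = 0"
  shows "transport_cost \<alpha> \<mu> \<mu> = 0"
proof -
  interpret real_distribution \<mu> by fact
  let ?\<pi> = "distr \<mu> (borel \<Otimes>\<^sub>M borel) (\<lambda>x. (x, x))"
  have [measurable]: "(\<lambda>x. (x, x)) \<in> measurable \<mu> (borel \<Otimes>\<^sub>M borel)"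
    by simp
  have "?\<pi> \<in> couplings \<mu> \<mu>"
    by (auto simp: couplings_def distr_distr comp_def distr_id2 intro!: prob_space_distr)
  then have "transport_cost \<alpha> \<mu> \<mu> \<le> (\<integral>\<^sup>+z. ennreal (\<alpha> (fst z - snd z)) \<partial>?\<pi>)"
    unfolding transport_cost_def by (rule INF_lower)
  also have "\<dots> = 0"
    by (subst nn_integral_distr) (auto simp: \<open>\<alpha> 0 = 0\<close>)
  finally show ?thesis by simp
qed

text \<open>This clears the denominator in the supremum. Monotonicity of \<psi> allows a mere upper
  bound \<open>h\<close> on the entropy, which is what data processing provides.\<close>

lemma transport_cost_le_constant:
  assumes "\<alpha> \<in> borel_measurable borel" "\<alpha> 0 = 0"
    and "mono_on {0..} \<psi>" and \<psi>_pos: "\<And>s. 0 < s \<Longrightarrow> 0 < \<psi> s"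
    and "real_distribution \<mu>" "real_distribution \<nu>" and le: "relative_entropy \<nu> \<mu> \<le> ereal h"
  shows "transport_cost \<alpha> \<mu> \<nu> \<le> transport_entropy_constant \<alpha> \<psi> \<mu> * ennreal (\<psi> h)"
proof (cases "\<nu> = \<mu>")
  case True
  then show ?thesis using transport_cost_self assms by simp
next
  case False
  interpret \<mu>: real_distribution \<mu> by fact
  interpret \<nu>: real_distribution \<nu> by fact
  let ?H = "relative_entropy \<nu> \<mu>"
  have pos: "0 < ?H"
    using False by (intro relative_entropy_pos) (auto simp: \<mu>.prob_space_axioms \<nu>.prob_space_axioms)
  define k where "k = real_of_ereal ?H"
  have k: "?H = ereal k" "0 < k" "k \<le> h"
    using pos le unfolding k_def by (cases ?H; simp)+
  have "transport_cost \<alpha> \<mu> \<nu> = transport_cost \<alpha> \<mu> \<nu> / ennreal (\<psi> k) * ennreal (\<psi> k)"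
    using \<psi>_pos[OF \<open>0 < k\<close>] by (simp add: ennreal_divide_times)
  also have "\<dots> \<le> transport_entropy_constant \<alpha> \<psi> \<mu> * ennreal (\<psi> h)"
  proof (rule mult_mono)
    show "transport_cost \<alpha> \<mu> \<nu> / ennreal (\<psi> k) \<le> transport_entropy_constant \<alpha> \<psi> \<mu>"
      unfolding transport_entropy_constant_def k_def
      by (rule SUP_upper) (use k assms in auto)
    show "ennreal (\<psi> k) \<le> ennreal (\<psi> h)"
      using k mono_onD[OF \<open>mono_on {0..} \<psi>\<close>, of k h] by (simp add: ennreal_leI)
  qed auto
  finally show ?thesis .
qed

text \<open>A coupling is itself a probability space whose coordinate maps have the prescribed laws,
  so the comonotone pair can be compared with it.\<close>

lemma comonotone_le_transport_cost:
  fixes \<alpha> :: "real \<Rightarrow> real"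
  assumes \<alpha>: "\<And>x. 0 \<le> \<alpha> x" "\<And>x. \<alpha> (- x) = \<alpha> x" "convex_on UNIV \<alpha>" "\<alpha> 0 = 0"
    and "prob_space M" and [measurable]: "X \<in> borel_measurable M" "Y \<in> borel_measurable M"
    and "comonotone_on (space M) X Y"
  shows "(\<integral>\<^sup>+\<omega>. ennreal (\<alpha> (X \<omega> - Y \<omega>)) \<partial>M) \<le>
    transport_cost \<alpha> (distr M borel X) (distr M borel Y)"
  unfolding transport_cost_def
proof (rule INF_greatest)
  fix \<pi> assume "\<pi> \<in> couplings (distr M borel X) (distr M borel Y)"
  then have "prob_space \<pi>" and sets[measurable_cong]: "sets \<pi> = sets (borel \<Otimes>\<^sub>M borel)"
    and "distr \<pi> borel fst = distr M borel X" "distr \<pi> borel snd = distr M borel Y"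
    by (auto simp: couplings_def)
  then show "(\<integral>\<^sup>+\<omega>. ennreal (\<alpha> (X \<omega> - Y \<omega>)) \<partial>M) \<le> (\<integral>\<^sup>+z. ennreal (\<alpha> (fst z - snd z)) \<partial>\<pi>)"
    by (intro comonotone_cost_le assms) measurable
qed

section \<open>Convexity along combinations of monotone maps\<close>

text \<open>Arbitrary monotone \<open>X0\<close> and \<open>X1\<close> are allowed so that they can
  be the interpolated quantiles at any two times, not only at the end points.\<close>

lemma transport_entropy_constant_mono_combination_le:
  fixes \<alpha> \<psi> X0 X1 :: "real \<Rightarrow> real"
  assumes \<alpha>: "\<And>x. 0 \<le> \<alpha> x" "\<And>x. \<alpha> (- x) = \<alpha> x" "convex_on UNIV \<alpha>" "\<alpha> 0 = 0"
    and \<psi>: "mono_on {0..} \<psi>" "\<And>s. 0 < s \<Longrightarrow> 0 < \<psi> s"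
    and X0: "mono_on {0<..<1} X0" and X1: "mono_on {0<..<1} X1"
    and uv: "0 \<le> u" "0 \<le> v" "u + v = 1"
  shows "transport_entropy_constant \<alpha> \<psi>
      (distr unit_interval_measure borel (\<lambda>\<omega>. u * X0 \<omega> + v * X1 \<omega>)) \<le>
    ennreal u * transport_entropy_constant \<alpha> \<psi> (distr unit_interval_measure borel X0) +
    ennreal v * transport_entropy_constant \<alpha> \<psi> (distr unit_interval_measure borel X1)"
proof -
  let ?\<Omega> = "unit_interval_measure"
  define X where "X \<omega> = u * X0 \<omega> + v * X1 \<omega>" for \<omega>
  interpret \<Omega>: prob_space ?\<Omega> by (rule prob_space_unit_interval_measure)
  note X0_meas[measurable] = measurable_unit_interval_mono[OF X0]
  note X1_meas[measurable] = measurable_unit_interval_mono[OF X1]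
  have X_meas[measurable]: "X \<in> borel_measurable ?\<Omega>" unfolding X_def by measurable
  have [measurable]: "\<alpha> \<in> borel_measurable borel"
    using convex_on_continuous[OF open_UNIV \<alpha>(3)] by (rule borel_measurable_continuous_onI)
  let ?C0 = "transport_entropy_constant \<alpha> \<psi> (distr ?\<Omega> borel X0)"
  let ?C1 = "transport_entropy_constant \<alpha> \<psi> (distr ?\<Omega> borel X1)"
  have "transport_cost \<alpha> (distr ?\<Omega> borel X) \<nu> / ennreal (\<psi> (real_of_ereal (relative_entropy \<nu> (distr ?\<Omega> borel X))))
      \<le> ennreal u * ?C0 + ennreal v * ?C1"
    if "real_distribution \<nu>" and pos: "0 < relative_entropy \<nu> (distr ?\<Omega> borel X)"
      and fin: "relative_entropy \<nu> (distr ?\<Omega> borel X) < \<infinity>" for \<nu>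
  proof -
    let ?\<mu> = "distr ?\<Omega> borel X"
    interpret \<nu>: real_distribution \<nu> by fact
    interpret \<mu>: prob_space ?\<mu> by (rule \<Omega>.prob_space_distr) measurable
    have "absolutely_continuous ?\<mu> \<nu>"
      using fin by (auto simp: relative_entropy_def split: if_splits)
    then obtain f :: "real \<Rightarrow> real" where f[measurable]: "f \<in> measurable borel (borel :: real measure)"
      and f_nn: "\<And>x. 0 \<le> f x" and \<nu>_eq: "\<nu> = density ?\<mu> f"
      using absolutely_continuous_real_density[OF \<mu>.sigma_finite_measure_axioms
          \<nu>.finite_measure_axioms] by auto
    define g where "g \<omega> = f (X \<omega>)" for \<omega>
    have g[measurable]: "g \<in> borel_measurable ?\<Omega>" unfolding g_def by measurable
    have g_nn: "0 \<le> g \<omega>" for \<omega> by (simp add: g_def f_nn)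
    let ?G = "density ?\<Omega> g"
    have \<nu>_eq': "\<nu> = distr ?G borel X"
      unfolding \<nu>_eq g_def by (rule density_distr) measurable
    have "emeasure ?G (space ?G) = emeasure \<nu> UNIV"
      unfolding \<nu>_eq' by (subst emeasure_distr) auto
    then have G: "prob_space ?G"
      using \<nu>.emeasure_space_1 by (intro prob_spaceI) simp
    interpret G: prob_space ?G by (rule G)
    define h where "h = real_of_ereal (relative_entropy \<nu> ?\<mu>)"
    have h: "relative_entropy \<nu> ?\<mu> = ereal h" "0 < h"
      using pos fin unfolding h_def by (cases "relative_entropy \<nu> ?\<mu>"; simp)+
    \<comment> \<open>\<open>g\<close> factors through \<open>X\<close>, so pulling back to the unit
      interval leaves the entropy equal to \<open>h\<close>.\<close>
    have h_eq: "relative_entropy ?G ?\<Omega> = ereal h"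
      using relative_entropy_density_distr[OF \<Omega>.prob_space_axioms X_meas f f_nn]
      unfolding h(1)[symmetric] \<nu>_eq g_def by simp
    \<comment> \<open>One map \<open>S\<close> serves \<open>X0\<close>, \<open>X1\<close> and
      \<open>X\<close> at once, which makes the three costs comparable pointwise.\<close>
    obtain S where S_mono: "mono_on {0<..<1} S" and S[measurable]: "S \<in> measurable ?\<Omega> ?\<Omega>"
      and S_distr: "distr ?\<Omega> ?\<Omega> S = ?G"
      by (rule monotone_rearrangement[OF G]) auto
    have S_range: "S \<omega> \<in> {0<..<1}" if "\<omega> \<in> {0<..<1}" for \<omega>
      using measurable_space[OF S, of \<omega>] that by (simp add: space_restrict_space)
    have distr_S: "distr ?\<Omega> borel (\<lambda>\<omega>. Z (S \<omega>)) = distr ?G borel Z"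
      if "Z \<in> borel_measurable ?\<Omega>" for Z :: "real \<Rightarrow> real"
      unfolding S_distr[symmetric] using distr_distr[OF that S] by (simp add: comp_def)
    \<comment> \<open>The pair \<open>Z\<close>, \<open>Z \<circ> S\<close> is comonotone, hence
      optimal for its marginals; by data processing their relative entropy is at most
      \<open>h\<close>.\<close>
    have component: "(\<integral>\<^sup>+\<omega>. ennreal (\<alpha> (Z \<omega> - Z (S \<omega>))) \<partial>?\<Omega>) \<le>
        transport_entropy_constant \<alpha> \<psi> (distr ?\<Omega> borel Z) * ennreal (\<psi> h)"
      if Z: "mono_on {0<..<1} Z" for Z
    proof -
      note Z_meas[measurable] = measurable_unit_interval_mono[OF Z]
      have "mono_on {0<..<1} (\<lambda>\<omega>. Z (S \<omega>))"
        using Z S_mono S_range by (auto simp: mono_on_def)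
      with Z have "comonotone_on (space ?\<Omega>) Z (\<lambda>\<omega>. Z (S \<omega>))"
        by (simp add: space_restrict_space comonotone_on_mono)
      then have "(\<integral>\<^sup>+\<omega>. ennreal (\<alpha> (Z \<omega> - Z (S \<omega>))) \<partial>?\<Omega>) \<le>
          transport_cost \<alpha> (distr ?\<Omega> borel Z) (distr ?\<Omega> borel (\<lambda>\<omega>. Z (S \<omega>)))"
        by (intro comonotone_le_transport_cost \<alpha> \<Omega>.prob_space_axioms) measurable
      also have "\<dots> = transport_cost \<alpha> (distr ?\<Omega> borel Z) (distr ?G borel Z)"
        by (simp only: distr_S[OF Z_meas])
      also have "\<dots> \<le> transport_entropy_constant \<alpha> \<psi> (distr ?\<Omega> borel Z) * ennreal (\<psi> h)"
      proof (rule transport_cost_le_constant)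
        show "relative_entropy (distr ?G borel Z) (distr ?\<Omega> borel Z) \<le> ereal h"
          unfolding h_eq[symmetric]
          by (intro relative_entropy_distr_le G \<Omega>.prob_space_axioms g_nn) measurable
        show "real_distribution (distr ?\<Omega> borel Z)" "real_distribution (distr ?G borel Z)"
          by (intro \<Omega>.real_distribution_distr G.real_distribution_distr; simp)+
      qed (use \<alpha> \<psi> in auto)
      finally show ?thesis .
    qed
    \<comment> \<open>For the combined map only an upper bound on the cost is needed, so this
      coupling just has to be admissible.\<close>
    let ?\<pi> = "distr ?\<Omega> (borel \<Otimes>\<^sub>M borel) (\<lambda>\<omega>. (X \<omega>, X (S \<omega>)))"
    have "?\<pi> \<in> couplings ?\<mu> \<nu>"
      unfolding couplings_def \<nu>_eq' distr_S[OF X_meas, symmetric]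
      by (auto simp: distr_distr comp_def intro!: \<Omega>.prob_space_distr)
    then have "transport_cost \<alpha> ?\<mu> \<nu> \<le> (\<integral>\<^sup>+z. ennreal (\<alpha> (fst z - snd z)) \<partial>?\<pi>)"
      unfolding transport_cost_def by (rule INF_lower)
    also have "\<dots> = (\<integral>\<^sup>+\<omega>. ennreal (\<alpha> (X \<omega> - X (S \<omega>))) \<partial>?\<Omega>)"
      by (subst nn_integral_distr) auto
    also have "\<dots> \<le> (\<integral>\<^sup>+\<omega>. ennreal u * ennreal (\<alpha> (X0 \<omega> - X0 (S \<omega>))) +
        ennreal v * ennreal (\<alpha> (X1 \<omega> - X1 (S \<omega>))) \<partial>?\<Omega>)"
    proof (intro nn_integral_mono)
      fix \<omega>
      have "X \<omega> - X (S \<omega>) = u *\<^sub>R (X0 \<omega> - X0 (S \<omega>)) + v *\<^sub>R (X1 \<omega> - X1 (S \<omega>))"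
        by (simp add: X_def algebra_simps)
      then have "\<alpha> (X \<omega> - X (S \<omega>)) \<le> u * \<alpha> (X0 \<omega> - X0 (S \<omega>)) + v * \<alpha> (X1 \<omega> - X1 (S \<omega>))"
        using \<alpha>(3) uv by (simp add: convex_on_def)
      then show "ennreal (\<alpha> (X \<omega> - X (S \<omega>))) \<le> ennreal u * ennreal (\<alpha> (X0 \<omega> - X0 (S \<omega>))) +
          ennreal v * ennreal (\<alpha> (X1 \<omega> - X1 (S \<omega>)))"
        using uv \<alpha>(1) by (simp flip: ennreal_mult ennreal_plus add: ennreal_leI)
    qed
    also have "\<dots> = ennreal u * (\<integral>\<^sup>+\<omega>. ennreal (\<alpha> (X0 \<omega> - X0 (S \<omega>))) \<partial>?\<Omega>) +
        ennreal v * (\<integral>\<^sup>+\<omega>. ennreal (\<alpha> (X1 \<omega> - X1 (S \<omega>))) \<partial>?\<Omega>)"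
      by (simp add: nn_integral_add nn_integral_cmult)
    also have "\<dots> \<le> ennreal u * (?C0 * ennreal (\<psi> h)) + ennreal v * (?C1 * ennreal (\<psi> h))"
      by (intro add_mono mult_left_mono component X0 X1) auto
    also have "\<dots> = (ennreal u * ?C0 + ennreal v * ?C1) * ennreal (\<psi> h)"
      by (simp add: algebra_simps)
    \<comment> \<open>Here \<open>\<psi> h\<close> is positive and finite, so it cancels even when a
      constant is infinite.\<close>
    finally have "transport_cost \<alpha> ?\<mu> \<nu> / ennreal (\<psi> h) \<le>
        (ennreal u * ?C0 + ennreal v * ?C1) * ennreal (\<psi> h) / ennreal (\<psi> h)"
      by (rule divide_right_mono_ennreal)
    also have "\<dots> = ennreal u * ?C0 + ennreal v * ?C1"
      using \<psi>(2)[OF h(2)] by (simp add: ennreal_mult_divide_eq)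
    finally show ?thesis by (simp add: h_def)
  qed
  then show ?thesis
    unfolding transport_entropy_constant_def[of _ _ "distr ?\<Omega> borel (\<lambda>\<omega>. u * X0 \<omega> + v * X1 \<omega>)"]
    by (intro SUP_least) (auto simp: X_def[abs_def])
qed

theorem theorem3p2:
  fixes \<alpha> \<psi> :: "real \<Rightarrow> real" and \<mu>0 \<mu>1 :: "real measure"
  assumes "\<And>x. 0 \<le> \<alpha> x"
    and "\<And>x. \<alpha> (- x) = \<alpha> x"
    and "convex_on UNIV \<alpha>"
    and "\<alpha> 0 = 0"
    and "\<And>s. 0 \<le> s \<Longrightarrow> 0 \<le> \<psi> s"
    and "mono_on {0..} \<psi>"
    and "\<psi> 0 = 0"
    and "\<And>s. 0 < s \<Longrightarrow> 0 < \<psi> s"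
    and "real_distribution \<mu>0"
    and "real_distribution \<mu>1"
  shows "ennreal_convex_on {0..1}
           (\<lambda>t. transport_entropy_constant \<alpha> \<psi> (monotone_interpolation \<mu>0 \<mu>1 t)) \<and>
         (\<forall>t\<in>{0<..<1}.
           transport_entropy_constant \<alpha> \<psi> (monotone_interpolation \<mu>0 \<mu>1 t)
             \<le> ennreal (1 - t) * transport_entropy_constant \<alpha> \<psi> \<mu>0
               + ennreal t * transport_entropy_constant \<alpha> \<psi> \<mu>1)"
proof -
  define Q where "Q t \<omega> = (1 - t) * quantile \<mu>0 \<omega> + t * quantile \<mu>1 \<omega>" for t \<omega>
  have interpolation: "monotone_interpolation \<mu>0 \<mu>1 t = distr unit_interval_measure borel (Q t)" for t
    by (simp add: monotone_interpolation_def Q_def[abs_def])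
  have Q_mono: "mono_on {0<..<1} (Q t)" if "t \<in> {0..1}" for t
    using that mono_on_quantile[OF assms(9)] mono_on_quantile[OF assms(10)]
    unfolding Q_def mono_on_def by (auto intro!: add_mono mult_left_mono)
  have convex: "transport_entropy_constant \<alpha> \<psi> (monotone_interpolation \<mu>0 \<mu>1 (u * s + v * t)) \<le>
      ennreal u * transport_entropy_constant \<alpha> \<psi> (monotone_interpolation \<mu>0 \<mu>1 s) +
      ennreal v * transport_entropy_constant \<alpha> \<psi> (monotone_interpolation \<mu>0 \<mu>1 t)"
    if "s \<in> {0..1}" "t \<in> {0..1}" and uv: "0 \<le> u" "0 \<le> v" "u + v = 1" for s t u v
  proof -
    have u: "u = 1 - v" using uv by simp
    \<comment> \<open>\<open>Q\<close> is affine in time, because the weights sum to 1.\<close>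
    have "Q (u * s + v * t) = (\<lambda>\<omega>. u * Q s \<omega> + v * Q t \<omega>)"
      by (rule ext) (simp add: Q_def u algebra_simps)
    then show ?thesis
      unfolding interpolation
      using transport_entropy_constant_mono_combination_le[OF assms(1-4,6,8) Q_mono Q_mono] that
      by simp
  qed
  have endpoints: "monotone_interpolation \<mu>0 \<mu>1 0 = \<mu>0" "monotone_interpolation \<mu>0 \<mu>1 1 = \<mu>1"
    using assms(9,10) by (simp_all add: monotone_interpolation_def distr_quantile)
  show ?thesis
  proof (intro conjI ballI)
    show "ennreal_convex_on {0..1}
        (\<lambda>t. transport_entropy_constant \<alpha> \<psi> (monotone_interpolation \<mu>0 \<mu>1 t))"
      unfolding ennreal_convex_on_def using convex by simp
  next
    fix t :: real assume "t \<in> {0<..<1}"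
    then show "transport_entropy_constant \<alpha> \<psi> (monotone_interpolation \<mu>0 \<mu>1 t)
        \<le> ennreal (1 - t) * transport_entropy_constant \<alpha> \<psi> \<mu>0
          + ennreal t * transport_entropy_constant \<alpha> \<psi> \<mu>1"
      using convex[of 0 1 "1 - t" t] by (simp add: endpoints)
  qed
qed

end
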